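(* For every integer $n\geqslant 2$ there exists a positive constant $\widetilde{b}_n$ such that $$f_n(c)\geqslant 1-a_n(1-c)-\widetilde{b}_n(1-c)^2$$ for all $c\in[0,1]$, where $a_n=2(n-1)\sin^2(\pi/(2n))$.
   Context: For closed subspaces $H_1,\dots,H_n$ ($n\geqslant 2$) of a complex Hilbert space $H$, put $H_0:=H_1\cap\dots\cap H_n$ and let $P_k$ be the orthogonal projection of $H$ onto $H_k$, $k=0,1,\dots,n$. The Friedrichs number is $$c_F(H_1,\dots,H_n):=\sup\left\{\frac{2}{n-1}\frac{\sum_{i<j}\mathrm{Re}\langle x_i,x_j\rangle}{\|x_1\|^2+\dots+\|x_n\|^2}\,:\, x_i\in H_i\ominus H_0,\ i=1,\dots,n,\ (x_1,\dots,x_n)\neq(0,\dots,0)\right\},$$ where $H_i\ominus H_0$ is the orthogonal complement of $H_0$ in $H_i$ (if all $H_i=H_0$, the supremum is over the empty set and is taken to be $0$). For $c\in[0,1]$, $$f_n(c):=\sup\{\|P_n\cdots P_2P_1-P_0\|\,:\, c_F(H_1,\dots,H_n)\leqslant c\},$$ the supremum being over all complex Hilbert spaces $H$ and all systems of closed subspaces $H_1,\dots,H_n$ of $H$ with $c_F(H_1,\dots,H_n)\leqslant c$. *)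

theory Defs
  imports "HOL-Analysis.Analysis" "HOL-Algebra.Module"
begin

text \<open>
  The supremum defining f_n ranges over all complex Hilbert spaces, so Hilbert spaces have to be
  objects of the logic rather than types: they are modules over the field of complex numbers in
  the sense of HOL-Algebra, equipped with an inner product. The fields \<^const>\<open>mult\<close> and
  \<^const>\<open>one\<close> that such a record inherits from rings play no role.
\<close>

definition complex_ring :: "complex ring" where
  "complex_ring = \<lparr>carrier = UNIV, mult = (*), one = 1, zero = 0, add = (+)\<rparr>"

lemma complex_ring_simps [simp]:
  "carrier complex_ring = UNIV" "mult complex_ring = (*)" "one complex_ring = 1"
  "zero complex_ring = 0" "add complex_ring = (+)"
  by (simp_all add: complex_ring_def)

lemma cring_complex_ring: "cring complex_ring"
proof (intro cringI abelian_groupI comm_monoidI)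
  fix x :: complex
  show "\<exists>y\<in>carrier complex_ring. y \<oplus>\<^bsub>complex_ring\<^esub> x = \<zero>\<^bsub>complex_ring\<^esub>"
    by (rule bexI [of _ "- x"]) auto
qed (auto simp: algebra_simps)

record 'a inner_space = "(complex, 'a) module" +
  cinner :: "'a \<Rightarrow> 'a \<Rightarrow> complex"

definition hnorm :: "('a, 'm) inner_space_scheme \<Rightarrow> 'a \<Rightarrow> real" where
  "hnorm H x = sqrt (Re (cinner H x x))"

text \<open>
  The locale \<^locale>\<open>Metric_space\<close> demands nonnegativity and symmetry of the distance on the whole
  type, whence the value 0 off the carrier.
\<close>

definition hdist :: "('a, 'm) inner_space_scheme \<Rightarrow> 'a \<Rightarrow> 'a \<Rightarrow> real" where
  "hdist H x y =
     (if x \<in> carrier H \<and> y \<in> carrier H then hnorm H (x \<ominus>\<^bsub>H\<^esub> y) else 0)"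

locale complex_inner_space = module complex_ring H for H (structure) +
  assumes cinner_add_left:
      "\<lbrakk>x \<in> carrier H; y \<in> carrier H; z \<in> carrier H\<rbrakk> \<Longrightarrow>
        cinner H (x \<oplus> y) z = cinner H x z + cinner H y z"
    and cinner_smult_left:
      "\<lbrakk>x \<in> carrier H; y \<in> carrier H\<rbrakk> \<Longrightarrow> cinner H (a \<odot> x) y = a * cinner H x y"
    and cinner_commute:
      "\<lbrakk>x \<in> carrier H; y \<in> carrier H\<rbrakk> \<Longrightarrow> cinner H x y = cnj (cinner H y x)"
    and cinner_pos:
      "\<lbrakk>x \<in> carrier H; x \<noteq> \<zero>\<rbrakk> \<Longrightarrow> 0 < Re (cinner H x x)"

context complex_inner_space
begin

lemma cinner_add_right:
  assumes "x \<in> carrier H" "y \<in> carrier H" "z \<in> carrier H"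
  shows "cinner H x (y \<oplus> z) = cinner H x y + cinner H x z"
  using assms cinner_add_left [of y z x]
    cinner_commute [of x "y \<oplus> z"] cinner_commute [of x y] cinner_commute [of x z]
  by simp

lemma cinner_smult_right:
  assumes "x \<in> carrier H" "y \<in> carrier H"
  shows "cinner H x (a \<odot> y) = cnj a * cinner H x y"
  using assms cinner_smult_left [of y x a] smult_closed [of a y]
    cinner_commute [of x "a \<odot> y"] cinner_commute [of x y]
  by simp

lemma cinner_zero: "x \<in> carrier H \<Longrightarrow> cinner H \<zero> x = 0"
  using cinner_add_left [of \<zero> \<zero> x] by simp

lemma cinner_self_nonneg: "x \<in> carrier H \<Longrightarrow> 0 \<le> Re (cinner H x x)"
  using cinner_pos [of x] cinner_zero [of \<zero>] by (cases "x = \<zero>") auto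

lemma hnorm_nonneg: "x \<in> carrier H \<Longrightarrow> 0 \<le> hnorm H x"
  by (simp add: hnorm_def cinner_self_nonneg)

lemma hnorm_power2: "x \<in> carrier H \<Longrightarrow> (hnorm H x)\<^sup>2 = Re (cinner H x x)"
  by (simp add: hnorm_def cinner_self_nonneg)

lemma hnorm_eq_0: "x \<in> carrier H \<Longrightarrow> hnorm H x = 0 \<longleftrightarrow> x = \<zero>"
  using cinner_pos [of x] cinner_zero [of \<zero>] by (cases "x = \<zero>") (auto simp: hnorm_def)

lemma hnorm_smult:
  assumes "x \<in> carrier H"
  shows "hnorm H (of_real t \<odot> x) = \<bar>t\<bar> * hnorm H x"
proof -
  have "Re (cinner H (of_real t \<odot> x) (of_real t \<odot> x)) = t\<^sup>2 * Re (cinner H x x)"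
    using assms smult_closed [of "of_real t" x]
    by (simp add: cinner_smult_left cinner_smult_right power2_eq_square)
  then show ?thesis by (simp add: hnorm_def real_sqrt_mult)
qed

lemma hnorm_add_power2:
  assumes "x \<in> carrier H" "y \<in> carrier H"
  shows "(hnorm H (x \<oplus> y))\<^sup>2 = (hnorm H x)\<^sup>2 + 2 * Re (cinner H x y) + (hnorm H y)\<^sup>2"
proof -
  have "Re (cinner H y x) = Re (cinner H x y)"
    using cinner_commute [of y x] assms by simp
  then show ?thesis
    using assms by (simp add: hnorm_power2 cinner_add_left cinner_add_right)
qed

lemma Re_cinner_le:
  assumes x: "x \<in> carrier H" and y: "y \<in> carrier H"
  shows "Re (cinner H x y) \<le> hnorm H x * hnorm H y"
proof (cases "y = \<zero>")
  case True
  then show ?thesis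
    using x cinner_commute [of x y] cinner_zero [of x] hnorm_eq_0 [of y] by simp
next
  case False
  define a where "a = hnorm H x"
  define b where "b = hnorm H y"
  define r where "r = Re (cinner H x y)"
  have b: "b > 0" using False y hnorm_eq_0 hnorm_nonneg unfolding b_def by (metis less_eq_real_def)
  have a: "a \<ge> 0" using x hnorm_nonneg by (simp add: a_def)
  define t where "t = - r / b\<^sup>2"
  have ty: "of_real t \<odot> y \<in> carrier H" using smult_closed [of "of_real t" y] y by simp
  have "0 \<le> (hnorm H (x \<oplus> of_real t \<odot> y))\<^sup>2" by simp
  also have "\<dots> = a\<^sup>2 + 2 * (t * r) + (t * b)\<^sup>2"
    using x y ty
    by (simp add: hnorm_add_power2 hnorm_smult cinner_smult_right a_def b_def r_def
        power_mult_distrib)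
  also have "\<dots> = a\<^sup>2 - r\<^sup>2 / b\<^sup>2"
    using b by (simp add: t_def field_simps power2_eq_square)
  finally have "r\<^sup>2 / b\<^sup>2 \<le> a\<^sup>2" by simp
  then have "r\<^sup>2 \<le> (a * b)\<^sup>2"
    using b by (simp add: pos_divide_le_eq power_mult_distrib)
  then have "r \<le> a * b"
    by (rule power2_le_imp_le) (use a b in simp)
  then show ?thesis by (simp add: a_def b_def r_def)
qed

lemma hnorm_triangle:
  assumes x: "x \<in> carrier H" and y: "y \<in> carrier H"
  shows "hnorm H (x \<oplus> y) \<le> hnorm H x + hnorm H y"
proof (rule power2_le_imp_le)
  show "(hnorm H (x \<oplus> y))\<^sup>2 \<le> (hnorm H x + hnorm H y)\<^sup>2"
    using Re_cinner_le [OF x y] x y by (simp add: hnorm_add_power2 power2_sum)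
qed (use x y hnorm_nonneg in simp)

sublocale Metric_space "carrier H" "hdist H"
proof
  fix x y z
  have swap: "hnorm H (x \<ominus> y) = hnorm H (y \<ominus> x)" if "x \<in> carrier H" "y \<in> carrier H" for x y
  proof -
    have "y \<ominus> x = of_real (-1) \<odot> (x \<ominus> y)"
    proof -
      have m: "of_real (-1) = \<ominus>\<^bsub>complex_ring\<^esub> \<one>\<^bsub>complex_ring\<^esub>"
        using cring_complex_ring R.minus_equality [of "-1" 1] by simp
      have "of_real (-1) \<odot> (x \<ominus> y) = \<ominus> (x \<ominus> y)"
        unfolding m using that by (subst smult_l_minus) (auto simp: smult_one [simplified])
      also have "\<dots> = y \<ominus> x"
        using that by (simp add: a_minus_def M.minus_add M.add.m_comm)
      finally show ?thesis by simp
    qed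
    then show ?thesis using that hnorm_smult [of "x \<ominus> y" "-1"] by simp
  qed
  show "0 \<le> hdist H x y" by (simp add: hdist_def hnorm_nonneg)
  show "hdist H x y = hdist H y x" using swap by (auto simp: hdist_def)
  show "hdist H x y = 0 \<longleftrightarrow> x = y" if "x \<in> carrier H" "y \<in> carrier H"
    using that M.add.inv_solve_right' [of \<zero> x y]
    by (auto simp: hdist_def hnorm_eq_0 a_minus_def M.r_neg)
  show "hdist H x z \<le> hdist H x y + hdist H y z"
    if "x \<in> carrier H" "y \<in> carrier H" "z \<in> carrier H"
  proof -
    have "x \<ominus> z = (x \<ominus> y) \<oplus> (y \<ominus> z)"
      using that by (simp add: a_minus_def M.a_assoc M.r_neg1 M.r_neg2)
    then show ?thesis using that hnorm_triangle [of "x \<ominus> y" "y \<ominus> z"] by (simp add: hdist_def)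
  qed
qed

end

locale complex_hilbert_space = complex_inner_space +
  assumes complete: "Metric_space.mcomplete (carrier H) (hdist H)"

definition closed_subspace :: "('a, 'm) inner_space_scheme \<Rightarrow> 'a set \<Rightarrow> bool" where
  "closed_subspace H S \<longleftrightarrow> submodule S complex_ring H \<and>
     closedin (Metric_space.mtopology (carrier H) (hdist H)) S"

definition orth_proj :: "('a, 'm) inner_space_scheme \<Rightarrow> 'a set \<Rightarrow> 'a \<Rightarrow> 'a" where
  "orth_proj H S x = (THE y. y \<in> S \<and> (\<forall>z\<in>S. cinner H (x \<ominus>\<^bsub>H\<^esub> y) z = 0))"

definition orth_diff :: "('a, 'm) inner_space_scheme \<Rightarrow> 'a set \<Rightarrow> 'a set \<Rightarrow> 'a set" where
  "orth_diff H S T = {x \<in> S. \<forall>y\<in>T. cinner H x y = 0}"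

definition op_norm :: "('a, 'm) inner_space_scheme \<Rightarrow> ('a \<Rightarrow> 'a) \<Rightarrow> real" where
  "op_norm H T = Sup {hnorm H (T x) |x. x \<in> carrier H \<and> hnorm H x \<le> 1}"

text \<open>A system of n subspaces is a function on the indices 1, ..., n; other indices are ignored.\<close>

definition common_part :: "nat \<Rightarrow> (nat \<Rightarrow> 'a set) \<Rightarrow> 'a set" where
  "common_part n S = (\<Inter>k\<in>{1..n}. S k)"

definition friedrichs_set ::
    "('a, 'm) inner_space_scheme \<Rightarrow> nat \<Rightarrow> (nat \<Rightarrow> 'a set) \<Rightarrow> real set" where
  "friedrichs_set H n S =
     {2 / (real n - 1) *
        ((\<Sum>j=1..n. \<Sum>i\<in>{1..<j}. Re (cinner H (x i) (x j))) / (\<Sum>i=1..n. (hnorm H (x i))\<^sup>2)) |x.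
      (\<forall>i\<in>{1..n}. x i \<in> orth_diff H (S i) (common_part n S)) \<and>
      (\<exists>i\<in>{1..n}. x i \<noteq> \<zero>\<^bsub>H\<^esub>)}"

definition friedrichs_number ::
    "('a, 'm) inner_space_scheme \<Rightarrow> nat \<Rightarrow> (nat \<Rightarrow> 'a set) \<Rightarrow> real" where
  "friedrichs_number H n S =
     (if friedrichs_set H n S = {} then 0 else Sup (friedrichs_set H n S))"

primrec proj_product ::
    "('a, 'm) inner_space_scheme \<Rightarrow> (nat \<Rightarrow> 'a set) \<Rightarrow> nat \<Rightarrow> 'a \<Rightarrow> 'a" where
  "proj_product H S 0 x = x"
| "proj_product H S (Suc k) x = orth_proj H (S (Suc k)) (proj_product H S k x)"

text \<open>
  The type argument is the universe from which the elements of the Hilbert spaces are taken: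
  the supremum is over all complex Hilbert spaces whose carrier is a subset of the type. Every
  separable complex Hilbert space other than the zero space has the cardinality of the continuum,
  so a universe accommodates all of them as soon as it is at least as large as the continuum.

  The set of norms is nonempty for c in the unit interval (zero space) and bounded above by 1.
\<close>

definition f_rate :: "'a itself \<Rightarrow> nat \<Rightarrow> real \<Rightarrow> real" where
  "f_rate _ n c =
     Sup {op_norm H (\<lambda>x. proj_product H S n x \<ominus>\<^bsub>H\<^esub> orth_proj H (common_part n S) x) |
            (H :: 'a inner_space) S.
          complex_hilbert_space H \<and> (\<forall>k\<in>{1..n}. closed_subspace H (S k)) \<and>
          friedrichs_number H n S \<le> c}"

end

theory Submission
  imports Defs
begin

text \<open>
  Systems of lines in the complex plane of dimension two already attain the lower bound. Let \<open>H\<^sub>i\<close> be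
  spanned by \<open>(cos \<theta>\<^sub>i, sin \<theta>\<^sub>i)\<close>. If the lines do not all coincide, then \<open>H\<^sub>0 = 0\<close> and the norm of
  \<open>P\<^sub>n \<cdots> P\<^sub>1\<close> is the product of the \<open>\<bar>cos (\<theta>\<^sub>i\<^sub>+\<^sub>1 - \<theta>\<^sub>i)\<bar>\<close>, roughly \<open>1 - \<Sum> (\<theta>\<^sub>i\<^sub>+\<^sub>1 - \<theta>\<^sub>i)\<^sup>2 / 2\<close> for
  small angles. The Friedrichs number is \<open>(\<lambda> - 1) / (n - 1)\<close>, where \<open>\<lambda>\<close> is the largest eigenvalue of the Gram
  matrix of the unit vectors. If cosines and sines are orthogonal as vectors indexed by \<open>i\<close>, then
  \<open>\<lambda> = n - \<Sum> sin\<^sup>2 \<theta>\<^sub>i\<close> for small angles, so that \<open>(n - 1) (1 - c)\<close> is roughly \<open>\<Sum> \<theta>\<^sub>i\<^sup>2\<close>.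

  Orthogonality means, to first order, that the angles have mean zero. Among these systems the norm is
  therefore largest for a given \<open>c\<close>, to first order in \<open>1 - c\<close>, if the angles minimize
  \<open>\<Sum> (\<theta>\<^sub>i\<^sub>+\<^sub>1 - \<theta>\<^sub>i)\<^sup>2 / \<Sum> \<theta>\<^sub>i\<^sup>2\<close> among the vectors of mean zero. The minimum is the second smallest eigenvalue
  \<open>4 sin\<^sup>2 (\<pi> / (2 n))\<close> of the Laplacian of a path, attained at \<open>\<theta>\<^sub>i = \<epsilon> cos ((2 i - 1) \<pi> / (2 n))\<close>, and half of
  this eigenvalue times \<open>n - 1\<close> is the constant \<open>a\<^sub>n\<close>. Lemma \<open>f_rate_ge_near_1\<close> carries this out with explicit
  error terms for \<open>0 < 1 - c \<le> 1/6\<close>. For larger \<open>1 - c\<close> the constant \<open>b\<close> is chosen to make the bound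
  trivial, and \<open>c = 1\<close> follows by monotonicity and a limit.

  The supremum over all Hilbert spaces is a supremum of real numbers, which dominates its members only if
  it is taken over a bounded set. The boundedness rests on the existence of orthogonal projections onto
  closed subspaces of arbitrary Hilbert spaces; lemma \<open>op_norm_le_f_rate\<close> records the consequence.
\<close>

section \<open>Orthogonal projections in a complex Hilbert space\<close>

context complex_inner_space
begin

lemma cinner_diff_left:
  assumes "x \<in> carrier H" "y \<in> carrier H" "z \<in> carrier H"
  shows "cinner H (x \<ominus> y) z = cinner H x z - cinner H y z"
proof -
  have "(x \<ominus> y) \<oplus> y = x"
    using assms by (simp add: a_minus_def M.a_assoc M.l_neg)
  then show ?thesis
    using cinner_add_left [of "x \<ominus> y" y z] assms by simp
qed

lemma cinner_diff_right:
  assumes "x \<in> carrier H" "y \<in> carrier H" "z \<in> carrier H"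
  shows "cinner H x (y \<ominus> z) = cinner H x y - cinner H x z"
  using assms cinner_diff_left [of y z x]
    cinner_commute [of x "y \<ominus> z"] cinner_commute [of x y] cinner_commute [of x z]
  by simp

text \<open>
  The parallelogram law for the vectors \<open>x - y\<close> and \<open>x - z\<close>: two points of a subspace that are
  both almost as close to \<open>x\<close> as possible are close to each other, because their midpoint cannot be
  much closer.
\<close>

lemma parallelogram_midpoint:
  assumes "x \<in> carrier H" "y \<in> carrier H" "z \<in> carrier H"
  shows "(hnorm H (y \<ominus> z))\<^sup>2 =
    2 * (hnorm H (x \<ominus> y))\<^sup>2 + 2 * (hnorm H (x \<ominus> z))\<^sup>2
      - 4 * (hnorm H (x \<ominus> (1 / 2) \<odot> (y \<oplus> z)))\<^sup>2"
proof -
  have "(1 / 2) \<odot> (y \<oplus> z) \<in> carrier H"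
    using assms smult_closed [of "1 / 2"] by simp
  moreover have "cinner H y x = cnj (cinner H x y)" "cinner H z x = cnj (cinner H x z)"
    "cinner H z y = cnj (cinner H y z)"
    using assms by (auto intro: cinner_commute)
  ultimately show ?thesis
    using assms
    by (simp add: hnorm_power2 cinner_diff_left cinner_diff_right cinner_add_left cinner_add_right
        cinner_smult_left cinner_smult_right algebra_simps)
qed

lemma closed_subspace_carrier: "closed_subspace H S \<Longrightarrow> S \<subseteq> carrier H"
  using submoduleE(1) by (auto simp: closed_subspace_def)

lemma closed_subspace_zero: "closed_subspace H S \<Longrightarrow> \<zero> \<in> S"
  using subgroup.one_closed [of S "add_monoid H"]
  by (auto simp: closed_subspace_def submodule_def)

lemma closed_subspace_add:
  "\<lbrakk>closed_subspace H S; x \<in> S; y \<in> S\<rbrakk> \<Longrightarrow> x \<oplus> y \<in> S"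
  using submoduleE(5) by (auto simp: closed_subspace_def)

lemma closed_subspace_diff:
  "\<lbrakk>closed_subspace H S; x \<in> S; y \<in> S\<rbrakk> \<Longrightarrow> x \<ominus> y \<in> S"
  using submoduleE(3,5) by (auto simp: closed_subspace_def a_minus_def)

lemma closed_subspace_smult:
  "\<lbrakk>closed_subspace H S; x \<in> S\<rbrakk> \<Longrightarrow> a \<odot> x \<in> S"
  using submoduleE(4) [of S a] by (auto simp: closed_subspace_def)

lemma closed_subspace_common_part:
  assumes "1 \<le> n" and S: "\<And>k. k \<in> {1..n} \<Longrightarrow> closed_subspace H (S k)"
  shows "closed_subspace H (common_part n S)"
proof -
  have sub: "common_part n S \<subseteq> carrier H"
    using assms closed_subspace_carrier by (fastforce simp: common_part_def)
  have "\<ominus> a \<in> common_part n S" if "a \<in> common_part n S" for a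
    using that S submoduleE(3) by (fastforce simp: common_part_def closed_subspace_def)
  then have "submodule (common_part n S) complex_ring H"
    using sub S closed_subspace_zero closed_subspace_add closed_subspace_smult
    by (intro submoduleI) (auto simp: common_part_def)
  moreover have "closedin mtopology (common_part n S)"
    unfolding common_part_def using assms
    by (intro closedin_INT) (auto simp: closed_subspace_def)
  ultimately show ?thesis by (simp add: closed_subspace_def)
qed

end

context complex_hilbert_space
begin

text \<open>
  A minimizing sequence in \<open>S\<close> is Cauchy by the midpoint form of the parallelogram law, and its limit
  lies in \<open>S\<close> because \<open>S\<close> is closed.
\<close>

lemma closed_subspace_nearest:
  assumes S: "closed_subspace H S" and x: "x \<in> carrier H"
  obtains y where "y \<in> S" "\<And>z. z \<in> S \<Longrightarrow> hnorm H (x \<ominus> y) \<le> hnorm H (x \<ominus> z)"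
proof -
  note SH [simp, intro] = subsetD [OF closed_subspace_carrier [OF S]]
  define d where "d = Inf ((\<lambda>z. (hnorm H (x \<ominus> z))\<^sup>2) ` S)"
  have bdd: "bdd_below ((\<lambda>z. (hnorm H (x \<ominus> z))\<^sup>2) ` S)"
    by (rule bdd_belowI [of _ 0]) auto
  have d_le: "d \<le> (hnorm H (x \<ominus> z))\<^sup>2" if "z \<in> S" for z
    unfolding d_def using bdd that by (intro cInf_lower) auto
  have "\<exists>z\<in>S. (hnorm H (x \<ominus> z))\<^sup>2 < d + 1 / real (Suc k)" for k
    using cInf_lessD [of "(\<lambda>z. (hnorm H (x \<ominus> z))\<^sup>2) ` S" "d + 1 / real (Suc k)"]
      closed_subspace_zero [OF S]
    by (auto simp: d_def)
  then obtain y where yS: "\<And>k. y k \<in> S"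
    and y_less: "\<And>k. (hnorm H (x \<ominus> y k))\<^sup>2 < d + 1 / real (Suc k)"
    by metis
  have close: "(hdist H (y j) (y k))\<^sup>2 \<le> 2 / real (Suc j) + 2 / real (Suc k)" for j k
  proof -
    have "(1 / 2) \<odot> (y j \<oplus> y k) \<in> S"
      using closed_subspace_smult [OF S, of _ "1 / 2"] closed_subspace_add [OF S] yS by auto
    from d_le [OF this] show ?thesis
      using parallelogram_midpoint [of x "y j" "y k"] x yS [of j] yS [of k] y_less [of j] y_less [of k]
      by (simp add: hdist_def del: of_nat_Suc)
  qed
  have "MCauchy y"
    unfolding MCauchy_def
  proof (intro conjI allI impI)
    show "range y \<subseteq> carrier H" using yS by auto
    fix e :: real assume "e > 0"
    then obtain N where N: "4 / e\<^sup>2 < real (Suc N)"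
      by (meson less_Suc_eq reals_Archimedean2 less_trans of_nat_less_iff lessI)
    have "hdist H (y j) (y k) < e" if "N \<le> j" "N \<le> k" for j k
    proof (rule power2_less_imp_less)
      have "1 / real (Suc j) \<le> 1 / real (Suc N)" "1 / real (Suc k) \<le> 1 / real (Suc N)"
        using that by (auto simp: divide_simps)
      moreover have "4 / real (Suc N) < e\<^sup>2"
        using N \<open>e > 0\<close> by (simp add: field_simps)
      ultimately show "(hdist H (y j) (y k))\<^sup>2 < e\<^sup>2"
        using close [of j k] by simp
    qed (use \<open>e > 0\<close> in simp)
    then show "\<exists>N. \<forall>n n'. N \<le> n \<longrightarrow> N \<le> n' \<longrightarrow> hdist H (y n) (y n') < e" by blast
  qed
  then obtain l where l: "limitin mtopology y l sequentially"
    using complete by (auto simp: mcomplete_def)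
  have lS: "l \<in> S"
    using S l yS unfolding closed_subspace_def metric_closedin_iff_sequentially_closed by blast
  have lim0: "(\<lambda>k. hdist H (y k) l) \<longlonglongrightarrow> 0"
    using l by (simp add: limitin_metric_dist_null)
  show thesis
  proof (rule that [OF lS])
    fix z assume z: "z \<in> S"
    define q where "q = hnorm H (x \<ominus> z)"
    have q: "q \<ge> 0" using z x by (simp add: q_def hnorm_nonneg)
    have "hnorm H (x \<ominus> l) \<le> sqrt (q\<^sup>2 + 1 / real (Suc k)) + hdist H (y k) l" for k
    proof -
      have "hnorm H (x \<ominus> y k) \<le> sqrt (q\<^sup>2 + 1 / real (Suc k))"
        using y_less [of k] d_le [OF z] by (intro real_le_rsqrt) (simp add: q_def)
      then show ?thesis
        using triangle [of x "y k" l] x yS [of k] lS by (simp add: hdist_def)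
    qed
    moreover have "(\<lambda>k. sqrt (q\<^sup>2 + 1 / real (Suc k)) + hdist H (y k) l) \<longlonglongrightarrow> sqrt (q\<^sup>2 + 0) + 0"
      by (intro tendsto_intros lim0 LIMSEQ_Suc [OF lim_1_over_n])
    ultimately show "hnorm H (x \<ominus> l) \<le> hnorm H (x \<ominus> z)"
      using q LIMSEQ_le_const [of _ "sqrt (q\<^sup>2 + 0) + 0" "hnorm H (x \<ominus> l)"]
      by (auto simp: q_def)
  qed
qed

text \<open>
  Moving from the nearest point \<open>y\<close> along \<open>z\<close> by the multiple \<open>a = \<langle>x - y, z\<rangle> / \<parallel>z\<parallel>\<^sup>2\<close> lowers the
  squared distance to \<open>x\<close> by \<open>\<bar>\<langle>x - y, z\<rangle>\<bar>\<^sup>2 / \<parallel>z\<parallel>\<^sup>2\<close>, which must therefore vanish.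
\<close>

lemma nearest_orthogonal:
  assumes S: "closed_subspace H S" and x: "x \<in> carrier H" and y: "y \<in> S"
    and near: "\<And>z. z \<in> S \<Longrightarrow> hnorm H (x \<ominus> y) \<le> hnorm H (x \<ominus> z)" and z: "z \<in> S"
  shows "cinner H (x \<ominus> y) z = 0"
proof (cases "z = \<zero>")
  case True
  then show ?thesis
    using x y closed_subspace_carrier [OF S] cinner_zero [of "x \<ominus> y"]
      cinner_commute [of "x \<ominus> y" z] by auto
next
  case False
  note SH = subsetD [OF closed_subspace_carrier [OF S]]
  define u where "u = x \<ominus> y"
  define w where "w = cinner H u z"
  define N where "N = Re (cinner H z z)"
  define a where "a = w / of_real N"
  have zH: "z \<in> carrier H" and yH: "y \<in> carrier H" and uH: "u \<in> carrier H"
    using z y x SH by (auto simp: u_def)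
  have azH: "a \<odot> z \<in> carrier H" using zH smult_closed by simp
  have N: "N > 0" using cinner_pos [OF zH False] by (simp add: N_def)
  have zz: "cinner H z z = of_real N"
    using cinner_commute [OF zH zH] unfolding N_def
    by (metis Reals_cnj_iff of_real_Re)
  have zu: "cinner H z u = cnj w" using cinner_commute [OF zH uH] by (simp add: w_def)
  have "x \<ominus> (y \<oplus> a \<odot> z) = u \<ominus> a \<odot> z"
    using x yH azH by (simp add: u_def a_minus_def M.minus_add M.a_assoc)
  moreover have "y \<oplus> a \<odot> z \<in> S"
    using closed_subspace_add [OF S y closed_subspace_smult [OF S z]] .
  ultimately have "hnorm H u \<le> hnorm H (u \<ominus> a \<odot> z)"
    using near [of "y \<oplus> a \<odot> z"] by (simp add: u_def)
  then have "(hnorm H u)\<^sup>2 \<le> (hnorm H (u \<ominus> a \<odot> z))\<^sup>2"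
    using uH by (intro power_mono hnorm_nonneg)
  also have "\<dots> = (hnorm H u)\<^sup>2 - 2 * Re (cnj a * w) + Re (a * cnj a) * N"
    using uH azH zH zu zz
    by (simp add: hnorm_power2 cinner_diff_left cinner_diff_right cinner_smult_left
        cinner_smult_right w_def [symmetric] algebra_simps)
  also have "\<dots> = (hnorm H u)\<^sup>2 - (cmod w)\<^sup>2 / N"
    using N unfolding a_def cmod_power2 by (simp add: field_simps power2_eq_square)
  finally have "(cmod w)\<^sup>2 / N \<le> 0" by simp
  then have "w = 0" using N by (simp add: divide_le_0_iff)
  then show ?thesis by (simp add: w_def u_def)
qed

end

context complex_inner_space
begin

lemma orth_proj_eqI:
  assumes S: "closed_subspace H S" and x: "x \<in> carrier H" and y: "y \<in> S"
    and orth: "\<And>z. z \<in> S \<Longrightarrow> cinner H (x \<ominus> y) z = 0"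
  shows "orth_proj H S x = y"
  unfolding orth_proj_def
proof (rule the_equality)
  show "y \<in> S \<and> (\<forall>z\<in>S. cinner H (x \<ominus> y) z = 0)" using y orth by simp
next
  fix y' assume y': "y' \<in> S \<and> (\<forall>z\<in>S. cinner H (x \<ominus> y') z = 0)"
  note SH = subsetD [OF closed_subspace_carrier [OF S]]
  have dS: "y' \<ominus> y \<in> S" using y y' closed_subspace_diff [OF S] by simp
  then have "cinner H (x \<ominus> y) (y' \<ominus> y) = 0" "cinner H (x \<ominus> y') (y' \<ominus> y) = 0"
    using y' orth by auto
  then have "cinner H (y' \<ominus> y) (y' \<ominus> y) = 0"
    using SH dS y y' x by (simp add: cinner_diff_left)
  then have "y' \<ominus> y = \<zero>"
    using cinner_pos [of "y' \<ominus> y"] SH [OF dS] by auto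
  moreover have "(y' \<ominus> y) \<oplus> y = y'"
    using SH y y' by (simp add: a_minus_def M.a_assoc M.l_neg)
  ultimately show "y' = y"
    using SH [OF y] by simp
qed

end

context complex_hilbert_space
begin

text \<open>
  The definite description in \<^const>\<open>orth_proj\<close> denotes the nearest point of \<open>S\<close>; the bound is the
  theorem of Pythagoras.
\<close>

lemma orth_proj_bound:
  assumes S: "closed_subspace H S" and x: "x \<in> carrier H"
  shows "orth_proj H S x \<in> carrier H" "hnorm H (orth_proj H S x) \<le> hnorm H x"
proof -
  note SH = subsetD [OF closed_subspace_carrier [OF S]]
  obtain y where y: "y \<in> S" and near: "\<And>z. z \<in> S \<Longrightarrow> hnorm H (x \<ominus> y) \<le> hnorm H (x \<ominus> z)"
    using closed_subspace_nearest [OF S x] by blast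
  have orth: "cinner H (x \<ominus> y) z = 0" if "z \<in> S" for z
    using nearest_orthogonal [OF S x y near that] .
  have eq: "orth_proj H S x = y" by (rule orth_proj_eqI [OF S x y orth])
  show "orth_proj H S x \<in> carrier H" using eq y SH by simp
  have yH: "y \<in> carrier H" using y SH by simp
  have "(x \<ominus> y) \<oplus> y = x"
    using x yH by (simp add: a_minus_def M.a_assoc M.l_neg)
  then have "(hnorm H x)\<^sup>2 = (hnorm H (x \<ominus> y))\<^sup>2 + (hnorm H y)\<^sup>2"
    using hnorm_add_power2 [of "x \<ominus> y" y] x yH orth [OF y] by simp
  then have "(hnorm H y)\<^sup>2 \<le> (hnorm H x)\<^sup>2" by simp
  then have "hnorm H y \<le> hnorm H x"
    by (rule power2_le_imp_le) (simp add: x hnorm_nonneg)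
  then show "hnorm H (orth_proj H S x) \<le> hnorm H x" using eq by simp
qed

lemma proj_product_bound:
  assumes "\<And>k. k \<in> {1..n} \<Longrightarrow> closed_subspace H (S k)" and "x \<in> carrier H"
  shows "proj_product H S n x \<in> carrier H \<and> hnorm H (proj_product H S n x) \<le> hnorm H x"
  using assms
proof (induction n)
  case (Suc n)
  then have "proj_product H S n x \<in> carrier H \<and> hnorm H (proj_product H S n x) \<le> hnorm H x"
    by simp
  with orth_proj_bound [of "S (Suc n)" "proj_product H S n x"] Suc.prems(1) [of "Suc n"]
  show ?case by auto
qed simp

lemma hnorm_diff_le:
  assumes x: "x \<in> carrier H" and y: "y \<in> carrier H"
  shows "hnorm H (x \<ominus> y) \<le> hnorm H x + hnorm H y"
proof -
  have minus_zero: "\<ominus> \<zero> = \<zero>" by (rule M.minus_equality) auto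
  have "hdist H x \<zero> = hnorm H x" "hdist H \<zero> y = hnorm H y"
    using x y commute [of \<zero> y] by (auto simp: hdist_def a_minus_def minus_zero)
  with triangle [of x \<zero> y] x y show ?thesis by (simp add: hdist_def)
qed

text \<open>
  The bound 2 is crude (the norm is at most 1), but uniform over all systems of subspaces. That is what
  a supremum of reals needs in order to dominate its members, both in \<^const>\<open>op_norm\<close> and in
  \<^const>\<open>f_rate\<close>.
\<close>

lemma
  assumes n: "1 \<le> n" and S: "\<And>k. k \<in> {1..n} \<Longrightarrow> closed_subspace H (S k)"
  defines "T \<equiv> \<lambda>x. proj_product H S n x \<ominus> orth_proj H (common_part n S) x"
  shows op_norm_proj_product_le: "op_norm H T \<le> 2"
    and hnorm_le_op_norm_proj_product:
      "\<And>x. \<lbrakk>x \<in> carrier H; hnorm H x \<le> 1\<rbrakk> \<Longrightarrow> hnorm H (T x) \<le> op_norm H T"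
proof -
  have bound: "hnorm H (T x) \<le> 2" if "x \<in> carrier H" "hnorm H x \<le> 1" for x
  proof -
    have "hnorm H (T x) \<le> hnorm H (proj_product H S n x) + hnorm H (orth_proj H (common_part n S) x)"
      unfolding T_def
      using proj_product_bound [OF S that(1)] orth_proj_bound [OF closed_subspace_common_part [OF n S] that(1)]
      by (intro hnorm_diff_le) auto
    also have "\<dots> \<le> hnorm H x + hnorm H x"
      using proj_product_bound [OF S that(1)] orth_proj_bound [OF closed_subspace_common_part [OF n S] that(1)]
      by (intro add_mono) auto
    finally show ?thesis using that by simp
  qed
  have "hnorm H \<zero> \<le> 1" using hnorm_eq_0 [of \<zero>] by simp
  then have ne: "hnorm H (T \<zero>) \<in> {hnorm H (T x) |x. x \<in> carrier H \<and> hnorm H x \<le> 1}" by auto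
  show "op_norm H T \<le> 2"
    unfolding op_norm_def using ne bound by (intro cSup_least) auto
  show "hnorm H (T x) \<le> op_norm H T" if "x \<in> carrier H" "hnorm H x \<le> 1" for x
    unfolding op_norm_def using that bound
    by (intro cSup_upper bdd_aboveI [of _ 2]) auto
qed

end

lemma op_norm_le_f_rate:
  assumes n: "1 \<le> n" and H: "complex_hilbert_space (H :: 'a inner_space)"
    and S: "\<And>k. k \<in> {1..n} \<Longrightarrow> closed_subspace H (S k)"
    and c: "friedrichs_number H n S \<le> c"
  shows "op_norm H (\<lambda>x. proj_product H S n x \<ominus>\<^bsub>H\<^esub> orth_proj H (common_part n S) x)
    \<le> f_rate TYPE('a) n c"
  unfolding f_rate_def
proof (rule cSup_upper)
  show "bdd_above {op_norm H (\<lambda>x. proj_product H S n x \<ominus>\<^bsub>H\<^esub> orth_proj H (common_part n S) x) |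
      (H :: 'a inner_space) S. complex_hilbert_space H \<and> (\<forall>k\<in>{1..n}. closed_subspace H (S k)) \<and>
      friedrichs_number H n S \<le> c}"
    using complex_hilbert_space.op_norm_proj_product_le [OF _ n]
    by (intro bdd_aboveI [of _ 2]) blast
qed (use assms in blast)

section \<open>Elementary inequalities and the lowest mode of a path\<close>

lemma sum_pairs_inner:
  fixes x :: "nat \<Rightarrow> 'a :: real_inner"
  shows "2 * (\<Sum>j=1..n. \<Sum>i\<in>{1..<j}. inner (x i) (x j)) =
    (norm (\<Sum>i=1..n. x i))\<^sup>2 - (\<Sum>i=1..n. (norm (x i))\<^sup>2)"
proof (induction n)
  case (Suc n)
  have "(\<Sum>i\<in>{1..<Suc n}. inner (x i) (x (Suc n))) = inner (\<Sum>i=1..n. x i) (x (Suc n))"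
    by (simp add: inner_sum_left atLeastLessThanSuc_atLeastAtMost)
  then show ?case
    using Suc.IH by (simp add: power2_norm_eq_inner inner_add_left inner_add_right inner_commute algebra_simps)
qed simp

text \<open>
  Bessel's inequality for two orthogonal vectors \<open>p\<close>, \<open>q\<close> whose squared norms are at most \<open>l\<close>: the
  matrix \<open>p p\<^sup>T + q q\<^sup>T\<close> has no eigenvalue above \<open>l\<close>. The proof expands the squared norm of
  \<open>l a - \<langle>a, p\<rangle> p - \<langle>a, q\<rangle> q\<close>.
\<close>

lemma bessel_two:
  fixes a p q :: "'i \<Rightarrow> real"
  assumes "(\<Sum>i\<in>I. p i * q i) = 0" and p: "(\<Sum>i\<in>I. (p i)\<^sup>2) \<le> l" and q: "(\<Sum>i\<in>I. (q i)\<^sup>2) \<le> l"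
    and l: "0 < l"
  shows "(\<Sum>i\<in>I. a i * p i)\<^sup>2 + (\<Sum>i\<in>I. a i * q i)\<^sup>2 \<le> l * (\<Sum>i\<in>I. (a i)\<^sup>2)"
proof -
  define u where "u = (\<Sum>i\<in>I. a i * p i)"
  define v where "v = (\<Sum>i\<in>I. a i * q i)"
  have "0 \<le> (\<Sum>i\<in>I. (l * a i - u * p i - v * q i)\<^sup>2)" by (simp add: sum_nonneg)
  also have "\<dots> = (\<Sum>i\<in>I. l\<^sup>2 * (a i)\<^sup>2 + u\<^sup>2 * (p i)\<^sup>2 + v\<^sup>2 * (q i)\<^sup>2
      - 2 * l * u * (a i * p i) - 2 * l * v * (a i * q i) + 2 * u * v * (p i * q i))"
    by (rule sum.cong) (auto simp: power2_eq_square algebra_simps)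
  also have "\<dots> = l\<^sup>2 * (\<Sum>i\<in>I. (a i)\<^sup>2) + u\<^sup>2 * (\<Sum>i\<in>I. (p i)\<^sup>2) + v\<^sup>2 * (\<Sum>i\<in>I. (q i)\<^sup>2)
      - 2 * l * u * u - 2 * l * v * v"
    using assms(1) by (simp add: sum.distrib sum_subtractf sum_distrib_left [symmetric] u_def v_def)
  also have "\<dots> \<le> l\<^sup>2 * (\<Sum>i\<in>I. (a i)\<^sup>2) + u\<^sup>2 * l + v\<^sup>2 * l - 2 * l * u * u - 2 * l * v * v"
    using mult_left_mono [OF p, of "u\<^sup>2"] mult_left_mono [OF q, of "v\<^sup>2"] by simp
  also have "\<dots> = l * (l * (\<Sum>i\<in>I. (a i)\<^sup>2) - (u\<^sup>2 + v\<^sup>2))"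
    by (simp add: power2_eq_square algebra_simps)
  finally have "0 \<le> l * (\<Sum>i\<in>I. (a i)\<^sup>2) - (u\<^sup>2 + v\<^sup>2)"
    using l by (simp add: zero_le_mult_iff)
  then show ?thesis by (simp add: u_def v_def)
qed

text \<open>
  For \<open>i = 1, \<dots>, n\<close> this is the eigenvector of the Laplacian of the path on \<open>n\<close> vertices that belongs
  to its second smallest eigenvalue \<open>4 sin\<^sup>2 (\<pi> / (2 n))\<close>. Among the vectors of mean zero it minimizes
  the sum of the squared steps relative to the sum of the squared entries.
\<close>

definition path_mode :: "nat \<Rightarrow> nat \<Rightarrow> real" where
  "path_mode n i = cos ((2 * real i - 1) * pi / (2 * real n))"

lemma path_mode_reflect:
  assumes "i \<in> {1..n}"
  shows "path_mode n (Suc n - i) = - path_mode n i"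
proof -
  have "(2 * real (Suc n - i) - 1) * pi / (2 * real n) = pi - (2 * real i - 1) * pi / (2 * real n)"
    using assms by (simp add: of_nat_diff field_simps)
  then show ?thesis by (simp add: path_mode_def cos_diff)
qed

lemma sum_odd_reflect:
  fixes f :: "nat \<Rightarrow> real"
  assumes "\<And>i. i \<in> {1..n} \<Longrightarrow> f (Suc n - i) = - f i"
  shows "(\<Sum>i=1..n. f i) = 0"
proof -
  have "(\<Sum>i=1..n. f i) = (\<Sum>i=1..n. f (Suc n - i))"
    by (rule sum.reindex_bij_witness [of _ "\<lambda>i. Suc n - i" "\<lambda>i. Suc n - i"]) auto
  also have "\<dots> = (\<Sum>i=1..n. - f i)"
    using assms by (intro sum.cong) auto
  finally show ?thesis by (simp add: sum_negf)
qed

text \<open>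
  The double angles \<open>(2 i - 1) \<pi> / n\<close> are the angles of \<open>n\<close> equally spaced points of the unit circle,
  so their cosines add up to zero; multiplied by \<open>2 sin (\<pi> / n)\<close> the sum telescopes.
\<close>

lemma sum_path_mode_power2:
  assumes n: "n \<ge> 2"
  shows "(\<Sum>i=1..n. (path_mode n i)\<^sup>2) = real n / 2"
proof -
  have pos: "sin (pi / real n) > 0" using n by (intro sin_gt_zero) (auto simp: field_simps)
  have step: "2 * sin (pi / real n) * (2 * (path_mode n i)\<^sup>2 - 1) =
      sin (2 * pi * real i / real n) - sin (2 * pi * real (i - 1) / real n)" if "i \<ge> 1" for i
  proof -
    define y where "y = (2 * real i - 1) * pi / real n"
    have "2 * (path_mode n i)\<^sup>2 - 1 = cos y"
      using cos_double_cos [of "(2 * real i - 1) * pi / (2 * real n)"]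
      by (simp add: path_mode_def y_def)
    moreover have "2 * pi * real i / real n = y + pi / real n"
        "2 * pi * real (i - 1) / real n = y - pi / real n"
      using n that by (auto simp: y_def of_nat_diff field_simps)
    ultimately show ?thesis by (simp add: sin_add sin_diff)
  qed
  have "2 * sin (pi / real n) * (\<Sum>i=1..n. 2 * (path_mode n i)\<^sup>2 - 1) =
      (\<Sum>i=1..n. sin (2 * pi * real i / real n) - sin (2 * pi * real (i - 1) / real n))"
    unfolding sum_distrib_left using step by (intro sum.cong) auto
  also have "\<dots> = sin (2 * pi * real n / real n) - sin (2 * pi * real 0 / real n)"
    using sum_telescope'' [of 0 n "\<lambda>i. sin (2 * pi * real i / real n)"]
    by (simp add: atLeastSucAtMost_greaterThanAtMost)
  also have "\<dots> = 0" using n by simp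
  finally have "(\<Sum>i=1..n. 2 * (path_mode n i)\<^sup>2 - 1) = 0" using pos by simp
  then show ?thesis by (simp add: sum_subtractf sum_distrib_left [symmetric])
qed

text \<open>
  Together with the preceding lemma this is the Rayleigh quotient \<open>4 sin\<^sup>2 (\<pi> / (2 n))\<close> of
  \<^const>\<open>path_mode\<close>. A step equals \<open>- 2 sin (\<pi> / (2 n)) sin (i \<pi> / n)\<close>, and the squares of the second
  factor are summed by the same telescoping.
\<close>

lemma sum_path_mode_steps:
  assumes n: "n \<ge> 2"
  shows "(\<Sum>i=1..<n. (path_mode n (Suc i) - path_mode n i)\<^sup>2) =
    2 * real n * (sin (pi / (2 * real n)))\<^sup>2"
proof -
  define b where "b = pi / (2 * real n)"
  have diff: "path_mode n (Suc i) - path_mode n i = - 2 * sin b * sin (2 * real i * b)" for i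
  proof -
    have "(2 * real (Suc i) - 1) * pi / (2 * real n) = 2 * real i * b + b"
      "(2 * real i - 1) * pi / (2 * real n) = 2 * real i * b - b"
      using n by (auto simp: b_def field_simps)
    then show ?thesis by (simp add: path_mode_def cos_add cos_diff)
  qed
  have pos: "sin (2 * b) > 0" using n by (intro sin_gt_zero) (auto simp: b_def field_simps)
  have step: "2 * sin (2 * b) * (1 - 2 * (sin (2 * real i * b))\<^sup>2) =
      sin (2 * (2 * real (Suc i) - 1) * b) - sin (2 * (2 * real i - 1) * b)" for i
  proof -
    have "1 - 2 * (sin (2 * real i * b))\<^sup>2 = cos (4 * real i * b)"
      using cos_double_sin [of "2 * real i * b"] by (simp add: mult.assoc)
    moreover have "2 * (2 * real (Suc i) - 1) * b = 4 * real i * b + 2 * b"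
      "2 * (2 * real i - 1) * b = 4 * real i * b - 2 * b"
      by (auto simp: algebra_simps)
    ultimately show ?thesis by (simp add: sin_add sin_diff)
  qed
  have "2 * sin (2 * b) * (\<Sum>i<n. 1 - 2 * (sin (2 * real i * b))\<^sup>2) =
      sin (2 * (2 * real n - 1) * b) - sin (2 * (2 * real 0 - 1) * b)"
    unfolding sum_distrib_left step
    by (rule sum_lessThan_telescope [of "\<lambda>i. sin (2 * (2 * real i - 1) * b)"])
  also have "\<dots> = 0"
  proof -
    have "2 * (2 * real n - 1) * b = 2 * pi - 2 * b" using n by (simp add: b_def field_simps)
    then show ?thesis by (simp add: sin_diff)
  qed
  finally have "(\<Sum>i<n. 1 - 2 * (sin (2 * real i * b))\<^sup>2) = 0" using pos by simp
  then have "(\<Sum>i<n. (sin (2 * real i * b))\<^sup>2) = real n / 2"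
    by (simp add: sum_subtractf sum_distrib_left [symmetric])
  moreover have "(\<Sum>i<n. (sin (2 * real i * b))\<^sup>2) = (\<Sum>i=1..<n. (sin (2 * real i * b))\<^sup>2)"
    by (rule sum.mono_neutral_right) (auto simp: not_less_eq_eq)
  ultimately have "(\<Sum>i=1..<n. (sin (2 * real i * b))\<^sup>2) = real n / 2" by simp
  then show ?thesis
    unfolding diff
    by (simp add: power_mult_distrib sum_distrib_left [symmetric] b_def)
qed

lemma prod_cos_ge:
  fixes d :: "'i \<Rightarrow> real"
  assumes "finite I" and "\<And>i. i \<in> I \<Longrightarrow> (d i)\<^sup>2 \<le> 2"
  shows "1 - (\<Sum>i\<in>I. (d i)\<^sup>2) / 2 \<le> (\<Prod>i\<in>I. cos (d i))"
proof -
  have "1 - (\<Sum>i\<in>I. (d i)\<^sup>2 / 2) \<le> (\<Prod>i\<in>I. 1 - (d i)\<^sup>2 / 2)"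
    using assms by (intro Weierstrass_prod_ineq) auto
  also have "\<dots> \<le> (\<Prod>i\<in>I. cos (d i))"
  proof (rule prod_mono)
    fix i assume "i \<in> I"
    have "(sin (d i / 2))\<^sup>2 \<le> (d i / 2)\<^sup>2"
      using abs_sin_x_le_abs_x [of "d i / 2"] by (simp only: abs_le_square_iff)
    then show "0 \<le> 1 - (d i)\<^sup>2 / 2 \<and> 1 - (d i)\<^sup>2 / 2 \<le> cos (d i)"
      using assms(2) [OF \<open>i \<in> I\<close>] cos_double_sin [of "d i / 2"] by (simp add: power_divide)
  qed
  finally show ?thesis by (simp add: sum_divide_distrib)
qed

lemma sin_power2_ge: "(sin x)\<^sup>2 \<ge> x\<^sup>2 - x ^ 4 / 3" for x :: real
proof -
  define r where "r = sin x - x"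
  have "{..<3::nat} = {0, 1, 2}" by auto
  then have "\<bar>r\<bar> \<le> \<bar>x\<bar> ^ 3 / 6"
    using Maclaurin_sin_bound [of x 3] by (simp add: r_def sin_coeff_def fact_numeral)
  then have "\<bar>x\<bar> * \<bar>r\<bar> \<le> \<bar>x\<bar> * (\<bar>x\<bar> ^ 3 / 6)"
    by (intro mult_left_mono) auto
  also have "\<dots> = x ^ 4 / 6"
    by (simp add: power_abs power4_eq_xxxx power3_eq_cube abs_mult)
  finally have "- (x ^ 4 / 6) \<le> x * r" by (simp add: abs_mult [symmetric] abs_le_iff)
  moreover have "(sin x)\<^sup>2 = x\<^sup>2 + 2 * (x * r) + r\<^sup>2"
    by (simp add: r_def power2_eq_square algebra_simps)
  ultimately show ?thesis using zero_le_power2 [of r] by linarith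
qed

section \<open>Systems of lines in a plane\<close>

definition plane_scale :: "complex \<Rightarrow> complex \<times> complex \<Rightarrow> complex \<times> complex" where
  "plane_scale a u = (a * fst u, a * snd u)"

definition plane_inner :: "complex \<times> complex \<Rightarrow> complex \<times> complex \<Rightarrow> complex" where
  "plane_inner u v = fst u * cnj (fst v) + snd u * cnj (snd v)"

lemma Re_plane_inner: "Re (plane_inner u v) = inner u v"
  by (simp add: plane_inner_def inner_prod_def inner_complex_def)

definition dir :: "real \<Rightarrow> complex \<times> complex" where
  "dir t = (of_real (cos t), of_real (sin t))"

lemma plane_inner_dir: "plane_inner (plane_scale a (dir s)) (dir t) = a * of_real (cos (t - s))"
  by (simp add: plane_inner_def plane_scale_def dir_def cos_diff algebra_simps)

lemma norm_plane_dir: "norm (plane_scale a (dir t)) = cmod a"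
proof -
  have "(cmod a * cos t)\<^sup>2 + (cmod a * sin t)\<^sup>2 = (cmod a)\<^sup>2"
    by (simp add: power_mult_distrib distrib_left [symmetric])
  then show ?thesis
    by (simp add: plane_scale_def dir_def norm_Pair norm_mult power_mult_distrib)
qed

text \<open>
  The squared norm on the left is the quadratic form of the Gram matrix of the directions. That matrix is
  \<open>c c\<^sup>T + s s\<^sup>T\<close> with \<open>c\<close>, \<open>s\<close> the vectors of cosines and sines, so Bessel's inequality applies to the
  real and to the imaginary parts of the coefficients.
\<close>

lemma norm_sum_directions_le:
  fixes t :: "'i \<Rightarrow> complex"
  assumes "(\<Sum>i\<in>I. cos (th i) * sin (th i)) = 0"
    and "(\<Sum>i\<in>I. (cos (th i))\<^sup>2) \<le> l" "(\<Sum>i\<in>I. (sin (th i))\<^sup>2) \<le> l" "0 < l"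
  shows "(norm (\<Sum>i\<in>I. plane_scale (t i) (dir (th i))))\<^sup>2 \<le> l * (\<Sum>i\<in>I. (cmod (t i))\<^sup>2)"
proof -
  have "(norm (\<Sum>i\<in>I. plane_scale (t i) (dir (th i))))\<^sup>2 =
      (cmod (\<Sum>i\<in>I. t i * of_real (cos (th i))))\<^sup>2 + (cmod (\<Sum>i\<in>I. t i * of_real (sin (th i))))\<^sup>2"
    by (simp add: norm_prod_def fst_sum snd_sum plane_scale_def dir_def)
  also have "\<dots> = ((\<Sum>i\<in>I. Re (t i) * cos (th i))\<^sup>2 + (\<Sum>i\<in>I. Re (t i) * sin (th i))\<^sup>2)
      + ((\<Sum>i\<in>I. Im (t i) * cos (th i))\<^sup>2 + (\<Sum>i\<in>I. Im (t i) * sin (th i))\<^sup>2)"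
    by (simp add: cmod_power2)
  also have "\<dots> \<le> l * (\<Sum>i\<in>I. (Re (t i))\<^sup>2) + l * (\<Sum>i\<in>I. (Im (t i))\<^sup>2)"
    by (intro add_mono bessel_two assms)
  also have "\<dots> = l * (\<Sum>i\<in>I. (cmod (t i))\<^sup>2)"
    by (simp add: cmod_power2 sum.distrib algebra_simps)
  finally show ?thesis .
qed

text \<open>
  A copy of the Hilbert space of pairs of complex numbers inside an arbitrary universe.
\<close>

locale embedded_plane =
  fixes g :: "complex \<times> complex \<Rightarrow> 'a"
  assumes inj: "inj g"
begin

definition plane :: "'a inner_space" where
  "plane = \<lparr>carrier = range g, mult = (\<lambda>x y. x), one = g 0, zero = g 0,
     add = (\<lambda>x y. g (inv_into UNIV g x + inv_into UNIV g y)),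
     smult = (\<lambda>a x. g (plane_scale a (inv_into UNIV g x))),
     cinner = (\<lambda>x y. plane_inner (inv_into UNIV g x) (inv_into UNIV g y))\<rparr>"

lemma plane_simps [simp]:
  "carrier plane = range g" "zero plane = g 0"
  "add plane (g u) (g v) = g (u + v)" "smult plane a (g u) = g (plane_scale a u)"
  "cinner plane (g u) (g v) = plane_inner u v"
  by (simp_all add: plane_def inv_f_f [OF inj])

lemma g_eq_iff [simp]: "g u = g v \<longleftrightarrow> u = v"
  using inj by (auto dest: injD)

lemma inner_space_plane: "complex_inner_space plane"
proof (intro complex_inner_space.intro moduleI complex_inner_space_axioms.intro
    cring_complex_ring abelian_groupI)
  fix x assume "x \<in> carrier plane"
  then obtain u where "x = g u" by auto
  then show "\<exists>y\<in>carrier plane. y \<oplus>\<^bsub>plane\<^esub> x = \<zero>\<^bsub>plane\<^esub>"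
    by (intro bexI [of _ "g (- u)"]) auto
next
  fix x assume "x \<in> carrier plane" "x \<noteq> \<zero>\<^bsub>plane\<^esub>"
  moreover then obtain u where "x = g u" by auto
  ultimately show "0 < Re (cinner plane x x)"
    by (simp add: Re_plane_inner)
qed (auto simp: plane_scale_def plane_inner_def algebra_simps)

sublocale P: complex_inner_space plane
  by (rule inner_space_plane)

lemma plane_minus [simp]: "g u \<ominus>\<^bsub>plane\<^esub> g v = g (u - v)"
proof -
  have "\<ominus>\<^bsub>plane\<^esub> g v = g (- v)"
    by (rule P.M.minus_equality) auto
  then show ?thesis by (simp add: a_minus_def)
qed

lemma hnorm_plane [simp]: "hnorm plane (g u) = norm u"
  by (simp add: hnorm_def Re_plane_inner norm_eq_sqrt_inner)

lemma hdist_plane [simp]: "hdist plane (g u) (g v) = dist u v"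
  by (simp add: hdist_def dist_norm)

lemma hilbert_space_plane: "complex_hilbert_space plane"
proof (intro complex_hilbert_space.intro complex_hilbert_space_axioms.intro inner_space_plane)
  show "P.mcomplete"
    unfolding P.mcomplete_def
  proof (intro allI impI)
    fix s assume s: "P.MCauchy s"
    then have "s k \<in> range g" for k
      unfolding P.MCauchy_def by auto
    then have "\<forall>k. \<exists>v. s k = g v" by blast
    then obtain u where u: "\<And>k. s k = g (u k)" by metis
    have "Cauchy u"
    proof -
      have "\<forall>e>0. \<exists>N. \<forall>j k. N \<le> j \<longrightarrow> N \<le> k \<longrightarrow> dist (u j) (u k) < e"
        using s unfolding P.MCauchy_def by (simp add: u)
      then show ?thesis unfolding Cauchy_def by blast
    qed
    then obtain l where "u \<longlonglongrightarrow> l"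
      using Cauchy_convergent_iff convergent_def by blast
    then have "limitin P.mtopology s (g l) sequentially"
      unfolding P.limit_metric_sequentially lim_sequentially by (simp add: u)
    then show "\<exists>x. limitin P.mtopology s x sequentially" ..
  qed
qed

definition line :: "real \<Rightarrow> 'a set" where
  "line t = range (\<lambda>a. g (plane_scale a (dir t)))"

text \<open>
  A linear equation for the line, from which its closedness is evident. The coordinate of a solution \<open>u\<close>
  along the line is \<open>fst u * cos t + snd u * sin t\<close>.
\<close>

lemma mem_line_iff: "g u \<in> line t \<longleftrightarrow> fst u * of_real (sin t) = snd u * of_real (cos t)"
proof
  assume "g u \<in> line t"
  then show "fst u * of_real (sin t) = snd u * of_real (cos t)"
    by (auto simp: line_def plane_scale_def dir_def)
next
  assume eq: "fst u * of_real (sin t) = snd u * of_real (cos t)"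
  have one: "of_real (cos t) * of_real (cos t) + of_real (sin t) * of_real (sin t) = (1 :: complex)"
    by (metis of_real_1 of_real_add of_real_mult power2_eq_square sin_cos_squared_add2)
  define a where "a = fst u * of_real (cos t) + snd u * of_real (sin t)"
  have "a * of_real (cos t) = fst u * (of_real (cos t) * of_real (cos t) + of_real (sin t) * of_real (sin t))"
    unfolding a_def distrib_left distrib_right using eq by (simp add: ac_simps)
  moreover have "a * of_real (sin t) = snd u * (of_real (cos t) * of_real (cos t) + of_real (sin t) * of_real (sin t))"
    unfolding a_def distrib_left distrib_right using eq by (simp add: ac_simps)
  ultimately have "u = plane_scale a (dir t)"
    by (simp add: one plane_scale_def dir_def prod_eq_iff)
  then show "g u \<in> line t" by (simp add: line_def)
qed

lemma mem_lineE:
  assumes "x \<in> line t"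
  obtains u where "x = g u" "g u \<in> line t"
  using assms by (fastforce simp only: line_def)

lemma closed_subspace_line: "closed_subspace plane (line t)"
  unfolding closed_subspace_def
proof
  show "submodule (line t) complex_ring plane"
  proof (rule P.submoduleI)
    show "line t \<subseteq> carrier plane" by (auto simp: line_def)
    show "\<zero>\<^bsub>plane\<^esub> \<in> line t" by (simp add: mem_line_iff)
    fix x assume "x \<in> line t"
    then obtain u where u: "x = g u" "g u \<in> line t" by (rule mem_lineE)
    have "\<ominus>\<^bsub>plane\<^esub> g u = g (- u)" by (rule P.M.minus_equality) auto
    then show "\<ominus>\<^bsub>plane\<^esub> x \<in> line t" using u by (simp add: mem_line_iff)
    show "a \<odot>\<^bsub>plane\<^esub> x \<in> line t" for a
      using u by (simp add: mem_line_iff plane_scale_def mult.assoc)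
    fix y assume "y \<in> line t"
    then obtain v where v: "y = g v" "g v \<in> line t" by (rule mem_lineE)
    show "x \<oplus>\<^bsub>plane\<^esub> y \<in> line t"
      using u v by (simp add: mem_line_iff distrib_right)
  qed
  show "closedin P.mtopology (line t)"
    unfolding P.metric_closedin_iff_sequentially_closed
  proof (intro conjI allI impI)
    show "line t \<subseteq> carrier plane" by (auto simp: line_def)
    fix s x assume *: "range s \<subseteq> line t \<and> limitin P.mtopology s x sequentially"
    then have "s k \<in> range g" for k by (force simp: line_def)
    then have "\<forall>k. \<exists>v. s k = g v" by blast
    then obtain u where u: "\<And>k. s k = g (u k)" by metis
    have "x \<in> range g" using * unfolding P.limit_metric_sequentially by simp
    then obtain l where l: "x = g l" by blast
    have lim: "u \<longlonglongrightarrow> l" using * unfolding P.limit_metric_sequentially lim_sequentially by (simp add: u l)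
    have "fst (u k) * of_real (sin t) = snd (u k) * of_real (cos t)" for k
      using * u mem_line_iff by (metis rangeI subsetD)
    moreover have "(\<lambda>k. fst (u k) * of_real (sin t)) \<longlonglongrightarrow> fst l * of_real (sin t)"
      "(\<lambda>k. snd (u k) * of_real (cos t)) \<longlonglongrightarrow> snd l * of_real (cos t)"
      by (intro tendsto_intros lim)+
    ultimately show "x \<in> line t" by (simp add: l mem_line_iff LIMSEQ_unique)
  qed
qed

lemma orth_proj_line:
  "orth_proj plane (line t) (g u) = g (plane_scale (plane_inner u (dir t)) (dir t))"
proof (rule P.orth_proj_eqI [OF closed_subspace_line])
  fix z assume "z \<in> line t"
  then obtain b where z: "z = g (plane_scale b (dir t))" by (auto simp: line_def)
  define w where "w = plane_inner u (dir t)"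
  have scale: "plane_inner x (plane_scale b y) = cnj b * plane_inner x y" for x y
    by (simp add: plane_inner_def plane_scale_def algebra_simps)
  have diff: "plane_inner (x - y) v = plane_inner x v - plane_inner y v" for x y v
    by (simp add: plane_inner_def algebra_simps)
  show "cinner plane (g u \<ominus>\<^bsub>plane\<^esub> g (plane_scale (plane_inner u (dir t)) (dir t))) z = 0"
    by (simp add: z scale diff plane_inner_dir w_def [symmetric])
qed (auto simp: line_def)

text \<open>
  Projecting a vector of the line at angle \<open>s\<close> onto the line at angle \<open>t\<close> multiplies its coordinate by
  \<open>cos (t - s)\<close>.
\<close>

lemma proj_product_lines:
  "proj_product plane (\<lambda>k. line (th k)) (Suc k) (g (dir (th 1))) =
    g (plane_scale (of_real (\<Prod>i=1..<Suc k. cos (th (Suc i) - th i))) (dir (th (Suc k))))"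
proof (induction k)
  case 0
  have "plane_inner (dir (th 1)) (dir (th 1)) = 1"
    using plane_inner_dir [of 1 "th 1" "th 1"] by (simp add: plane_scale_def)
  then show ?case by (simp add: orth_proj_line)
next
  case (Suc k)
  then show ?case
    by (subst proj_product.simps) (simp add: orth_proj_line plane_inner_dir del: proj_product.simps)
qed

lemma common_part_lines:
  assumes "n \<ge> 2" and "sin (th 1 - th n) \<noteq> 0"
  shows "common_part n (\<lambda>k. line (th k)) = {g 0}"
proof
  show "{g 0} \<subseteq> common_part n (\<lambda>k. line (th k))"
    by (simp add: common_part_def mem_line_iff)
  show "common_part n (\<lambda>k. line (th k)) \<subseteq> {g 0}"
  proof
    fix x assume "x \<in> common_part n (\<lambda>k. line (th k))"
    then have "x \<in> line (th 1)" "x \<in> line (th n)"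
      using assms(1) by (auto simp: common_part_def)
    then obtain a where x: "x = g (plane_scale a (dir (th 1)))"
      and "g (plane_scale a (dir (th 1))) \<in> line (th n)" by (auto simp: line_def)
    then have "a * of_real (cos (th 1) * sin (th n) - sin (th 1) * cos (th n)) = 0"
      by (simp add: mem_line_iff plane_scale_def dir_def algebra_simps)
    moreover have "cos (th 1) * sin (th n) - sin (th 1) * cos (th n) \<noteq> 0"
      using assms(2) by (simp add: sin_diff)
    ultimately have "a = 0" by (metis mult_eq_0_iff of_real_eq_0_iff)
    then show "x \<in> {g 0}" by (simp add: x plane_scale_def zero_prod_def)
  qed
qed

text \<open>
  Since the lines meet only in zero, \<open>P\<^sub>0 = 0\<close>, and the unit vector of the first line is mapped to
  the product of the cosines times a unit vector.
\<close>

lemma op_norm_lines_ge: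
  assumes n: "n \<ge> 2" and "sin (th 1 - th n) \<noteq> 0"
  shows "(\<Prod>i=1..<n. cos (th (Suc i) - th i)) \<le>
    op_norm plane (\<lambda>x. proj_product plane (\<lambda>k. line (th k)) n x
      \<ominus>\<^bsub>plane\<^esub> orth_proj plane (common_part n (\<lambda>k. line (th k))) x)"
proof -
  define p where "p = (\<Prod>i=1..<n. cos (th (Suc i) - th i))"
  let ?S = "\<lambda>k. line (th k)"
  have n': "Suc (n - 1) = n" "1 \<le> n" using n by auto
  have common: "common_part n ?S = {g 0}" using common_part_lines [where th = th, OF assms] .
  have "orth_proj plane {g 0} (g (dir (th 1))) = g 0"
  proof (rule P.orth_proj_eqI)
    show "closed_subspace plane {g 0}"
      using P.closed_subspace_common_part [OF n'(2) closed_subspace_line, of th] by (simp add: common)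
  qed (auto simp: plane_inner_def)
  moreover have "proj_product plane ?S n (g (dir (th 1))) = g (plane_scale (of_real p) (dir (th n)))"
    using proj_product_lines [of th "n - 1"] unfolding n' p_def .
  moreover have "norm (dir (th 1)) = 1"
    using norm_plane_dir [of 1 "th 1"] by (simp add: plane_scale_def)
  ultimately have "\<bar>p\<bar> \<le> op_norm plane (\<lambda>x. proj_product plane ?S n x
      \<ominus>\<^bsub>plane\<^esub> orth_proj plane (common_part n ?S) x)"
    using complex_hilbert_space.hnorm_le_op_norm_proj_product
      [OF hilbert_space_plane n'(2), of ?S "g (dir (th 1))"] closed_subspace_line
    by (simp add: common norm_plane_dir)
  then show ?thesis unfolding p_def by linarith
qed

text \<open>
  The quotient in the Friedrichs number is \<open>(\<parallel>\<Sum> x\<^sub>i\<parallel>\<^sup>2 / \<Sum> \<parallel>x\<^sub>i\<parallel>\<^sup>2 - 1) / (n - 1)\<close>, and the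
  hypotheses say that no eigenvalue of the Gram matrix exceeds \<open>1 + (n - 1) c\<close>.
\<close>

lemma friedrichs_number_lines_le:
  assumes n: "n \<ge> 2" and "0 \<le> c"
    and "(\<Sum>i=1..n. cos (th i) * sin (th i)) = 0"
    and "(\<Sum>i=1..n. (cos (th i))\<^sup>2) \<le> 1 + (real n - 1) * c"
    and "(\<Sum>i=1..n. (sin (th i))\<^sup>2) \<le> 1 + (real n - 1) * c"
  shows "friedrichs_number plane n (\<lambda>k. line (th k)) \<le> c"
proof -
  define l where "l = 1 + (real n - 1) * c"
  have l: "0 < l" using n \<open>0 \<le> c\<close> by (simp add: l_def add_pos_nonneg)
  have "r \<le> c" if mem: "r \<in> friedrichs_set plane n (\<lambda>k. line (th k))" for r
  proof -
    obtain x where r: "r = 2 / (real n - 1) *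
        ((\<Sum>j=1..n. \<Sum>i\<in>{1..<j}. Re (cinner plane (x i) (x j))) / (\<Sum>i=1..n. (hnorm plane (x i))\<^sup>2))"
      and x: "\<And>i. i \<in> {1..n} \<Longrightarrow> x i \<in> line (th i)"
      and nz: "\<exists>i\<in>{1..n}. x i \<noteq> \<zero>\<^bsub>plane\<^esub>"
      using mem unfolding friedrichs_set_def orth_diff_def by blast
    have "\<forall>i\<in>{1..n}. \<exists>a. x i = g (plane_scale a (dir (th i)))"
      using x unfolding line_def by blast
    then obtain t where t: "\<And>i. i \<in> {1..n} \<Longrightarrow> x i = g (plane_scale (t i) (dir (th i)))"
      by metis
    define v where "v i = plane_scale (t i) (dir (th i))" for i
    define N where "N = (\<Sum>i=1..n. (norm (v i))\<^sup>2)"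
    have xv: "x i = g (v i)" if "i \<in> {1..n}" for i using t [OF that] by (simp add: v_def)
    have "(\<Sum>j=1..n. \<Sum>i\<in>{1..<j}. Re (cinner plane (x i) (x j))) =
        (\<Sum>j=1..n. \<Sum>i\<in>{1..<j}. inner (v i) (v j))"
      by (intro sum.cong refl) (simp add: xv Re_plane_inner)
    moreover have "(\<Sum>i=1..n. (hnorm plane (x i))\<^sup>2) = N"
      unfolding N_def by (intro sum.cong refl) (simp add: xv)
    moreover have "2 * (\<Sum>j=1..n. \<Sum>i\<in>{1..<j}. inner (v i) (v j)) \<le> (real n - 1) * c * N"
    proof -
      have "(norm (\<Sum>i=1..n. v i))\<^sup>2 \<le> l * (\<Sum>i=1..n. (cmod (t i))\<^sup>2)"
        unfolding v_def using assms(3-5) l by (intro norm_sum_directions_le) (auto simp: l_def)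
      also have "(\<Sum>i=1..n. (cmod (t i))\<^sup>2) = N" by (simp add: N_def v_def norm_plane_dir)
      finally show ?thesis
        unfolding sum_pairs_inner by (simp add: N_def l_def algebra_simps)
    qed
    moreover have "0 < N"
    proof -
      obtain i where i: "i \<in> {1..n}" "x i \<noteq> \<zero>\<^bsub>plane\<^esub>" using nz by blast
      then have "0 < (norm (v i))\<^sup>2" using xv [of i] by simp
      also have "\<dots> \<le> N" unfolding N_def using i(1) by (intro member_le_sum) auto
      finally show ?thesis .
    qed
    ultimately have "r = 2 * (\<Sum>j=1..n. \<Sum>i\<in>{1..<j}. inner (v i) (v j)) / ((real n - 1) * N)"
      and "2 * (\<Sum>j=1..n. \<Sum>i\<in>{1..<j}. inner (v i) (v j)) \<le> c * ((real n - 1) * N)"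
      and "0 < (real n - 1) * N"
      using n r by (simp_all add: ac_simps)
    then show ?thesis by (simp only: pos_divide_le_eq)
  qed
  then show ?thesis
    using \<open>0 \<le> c\<close> unfolding friedrichs_number_def by (auto intro: cSup_least)
qed

lemma friedrichs_number_constant:
  "friedrichs_number plane n (\<lambda>k. line t) = 0"
proof (cases "n = 0")
  case True
  then show ?thesis by (simp add: friedrichs_number_def friedrichs_set_def)
next
  case False
  then have "common_part n (\<lambda>k. line t) = line t" by (simp add: common_part_def)
  moreover have "x = \<zero>\<^bsub>plane\<^esub>" if "x \<in> orth_diff plane (line t) (line t)" for x
    using that P.cinner_pos [of x] by (fastforce simp: orth_diff_def line_def)
  ultimately have "friedrichs_set plane n (\<lambda>k. line t) = {}"
    unfolding friedrichs_set_def by auto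
  then show ?thesis by (simp add: friedrichs_number_def)
qed

end

section \<open>The lower bound for the rate\<close>

lemma embedded_plane_f_rate_ge:
  fixes g :: "complex \<times> complex \<Rightarrow> 'a"
  assumes inj: "inj g" and n: "n \<ge> 2" and c: "0 \<le> c" and sep: "sin (th 1 - th n) \<noteq> 0"
    and orth: "(\<Sum>i=1..n. cos (th i) * sin (th i)) = 0"
    and C: "(\<Sum>i=1..n. (cos (th i))\<^sup>2) \<le> 1 + (real n - 1) * c"
    and S: "(\<Sum>i=1..n. (sin (th i))\<^sup>2) \<le> 1 + (real n - 1) * c"
  shows "(\<Prod>i=1..<n. cos (th (Suc i) - th i)) \<le> f_rate TYPE('a) n c"
proof -
  interpret embedded_plane g by (rule embedded_plane.intro [OF inj])
  have "op_norm plane (\<lambda>x. proj_product plane (\<lambda>k. line (th k)) n x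
      \<ominus>\<^bsub>plane\<^esub> orth_proj plane (common_part n (\<lambda>k. line (th k))) x) \<le> f_rate TYPE('a) n c"
    using n friedrichs_number_lines_le [OF n c orth C S]
    by (intro op_norm_le_f_rate hilbert_space_plane closed_subspace_line) auto
  then show ?thesis using op_norm_lines_ge [where th = th, OF n sep] by linarith
qed

text \<open>
  This covers the \<open>c\<close> that are too small for the lines below. If all subspaces are the same line, the
  Friedrichs number is zero, so this system competes for every \<open>c\<close>.
\<close>

lemma f_rate_nonneg:
  fixes g :: "complex \<times> complex \<Rightarrow> 'a"
  assumes inj: "inj g" and n: "n \<ge> 1" and c: "0 \<le> c"
  shows "0 \<le> f_rate TYPE('a) n c"
proof -
  interpret embedded_plane g by (rule embedded_plane.intro [OF inj])
  let ?S = "\<lambda>k :: nat. line 0"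
  let ?T = "\<lambda>x. proj_product plane ?S n x \<ominus>\<^bsub>plane\<^esub> orth_proj plane (common_part n ?S) x"
  have bound: "hnorm plane (?T (g 0)) \<le> op_norm plane ?T"
    by (rule complex_hilbert_space.hnorm_le_op_norm_proj_product
        [OF hilbert_space_plane n closed_subspace_line]) auto
  have common: "closed_subspace plane (common_part n ?S)"
    using P.closed_subspace_common_part [OF n closed_subspace_line] .
  have "?T (g 0) \<in> carrier plane"
    using complex_hilbert_space.proj_product_bound
        [OF hilbert_space_plane closed_subspace_line, of "g 0" "\<lambda>k. 0" n]
      complex_hilbert_space.orth_proj_bound [OF hilbert_space_plane common, of "g 0"]
    by (intro P.M.minus_closed) auto
  then have "0 \<le> hnorm plane (?T (g 0))" by (rule P.hnorm_nonneg)
  also note bound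
  also have "op_norm plane ?T \<le> f_rate TYPE('a) n c"
    using c n by (intro op_norm_le_f_rate hilbert_space_plane closed_subspace_line)
      (auto simp: friedrichs_number_constant)
  finally show ?thesis .
qed

text \<open>
  The lines are placed at the angles \<open>e * path_mode n i\<close>. The sum of the squared sines is
  \<open>e\<^sup>2 n / 2\<close> up to an error of order \<open>e\<^sup>4\<close>, and it has to be at least \<open>(n - 1) d\<close>. This asks for
  \<open>e\<^sup>2 = 2 (n - 1) d / n\<close> to first order, and the product of the cosines is then \<open>1 - a\<^sub>n d\<close> to first order.
  The second-order term \<open>6 d\<^sup>2\<close> in \<open>e\<^sup>2\<close> makes up for the error of the sines: it contributes
  \<open>3 n d\<^sup>2\<close> to the sum, and with \<open>e\<^sup>2 \<le> 3 d\<close> that error is at most \<open>n e\<^sup>4 / 3 \<le> 3 n d\<^sup>2\<close>.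

  The number \<open>c\<close> is allowed to be larger than \<open>1 - d\<close>, so that \<open>c = 1\<close> can be approached by letting \<open>d\<close>
  tend to zero.
\<close>

lemma f_rate_ge_near_1:
  fixes g :: "complex \<times> complex \<Rightarrow> 'a"
  assumes inj: "inj g" and n: "n \<ge> 2" and d: "0 < d" "d \<le> 1 / 6" and c: "1 - d \<le> c"
  shows "1 - 2 * (real n - 1) * (sin (pi / (2 * real n)))\<^sup>2 * d - 6 * real n * d\<^sup>2
    \<le> f_rate TYPE('a) n c"
proof -
  define e2 where "e2 = 2 * (real n - 1) / real n * d + 6 * d\<^sup>2"
  define e where "e = sqrt e2"
  define th where "th i = e * path_mode n i" for i
  have n0: "real n > 0" "real n \<ge> 2" using n by auto
  have "2 * (real n - 1) / real n * d \<le> 2 * d"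
    using d n0 by (intro mult_right_mono) (auto simp: field_simps)
  moreover have "6 * d\<^sup>2 \<le> d"
    using d by (simp add: power2_eq_square field_simps)
  ultimately have e2_le: "e2 \<le> 3 * d" by (simp add: e2_def)
  have e2_pos: "0 < e2" using d n0 by (auto simp: e2_def intro!: add_nonneg_pos)
  have e: "0 < e" "e\<^sup>2 = e2" using e2_pos by (auto simp: e_def)
  have mode_le: "\<bar>path_mode n i\<bar> \<le> 1" for i by (simp add: path_mode_def)
  have th2: "(th i)\<^sup>2 = e2 * (path_mode n i)\<^sup>2" for i
    by (simp add: th_def power_mult_distrib e)
  have th2_le: "(th i)\<^sup>2 \<le> e2" for i
    using mult_left_mono [of "(path_mode n i)\<^sup>2" 1 e2] mode_le [of i] e2_pos
    by (simp add: th2 abs_square_le_1)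
  have sum_th2: "(\<Sum>i=1..n. (th i)\<^sup>2) = e2 * real n / 2"
    by (simp only: th2 sum_distrib_left [symmetric] sum_path_mode_power2 [OF n])
  have reflect: "th (Suc n - i) = - th i" if "i \<in> {1..n}" for i
    using path_mode_reflect [OF that] by (simp add: th_def)
  \<comment> \<open>The angles are antisymmetric under \<open>i \<mapsto> n + 1 - i\<close>, hence so are the summands.\<close>
  have orth: "(\<Sum>i=1..n. cos (th i) * sin (th i)) = 0"
    by (rule sum_odd_reflect) (simp add: reflect)
  have S_ge: "(real n - 1) * d \<le> (\<Sum>i=1..n. (sin (th i))\<^sup>2)"
  proof -
    have "e2\<^sup>2 \<le> (3 * d)\<^sup>2" using e2_le e2_pos by (intro power_mono) auto
    then have "(real n - 1) * d \<le> e2 * real n / 2 - real n * (e2\<^sup>2 / 3)"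
      using n0 mult_left_mono [of "e2\<^sup>2" "(3 * d)\<^sup>2" "real n"]
      by (simp add: e2_def power_mult_distrib field_simps)
    also have "\<dots> = (\<Sum>i=1..n. (th i)\<^sup>2 - e2\<^sup>2 / 3)"
      by (simp only: sum_subtractf sum_th2) simp
    also have "\<dots> \<le> (\<Sum>i=1..n. (sin (th i))\<^sup>2)"
    proof (rule sum_mono)
      fix i
      have "th i ^ 4 \<le> e2\<^sup>2"
        using power_mono [OF th2_le [of i], of 2] by simp
      then show "(th i)\<^sup>2 - e2\<^sup>2 / 3 \<le> (sin (th i))\<^sup>2"
        using sin_power2_ge [of "th i"] by simp
    qed
    finally show ?thesis .
  qed
  have C: "(\<Sum>i=1..n. (cos (th i))\<^sup>2) \<le> 1 + (real n - 1) * (1 - d)"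
    using S_ge by (simp add: cos_squared_eq sum_subtractf algebra_simps)
  have "(\<Sum>i=1..n. (sin (th i))\<^sup>2) \<le> (\<Sum>i=1..n. (cos (th i))\<^sup>2)"
  proof (rule sum_mono)
    fix i
    have "(sin (th i))\<^sup>2 \<le> (th i)\<^sup>2"
      using abs_sin_x_le_abs_x [of "th i"] by (simp only: abs_le_square_iff)
    then have "(sin (th i))\<^sup>2 \<le> 1 / 2" using th2_le [of i] e2_le d by linarith
    then show "(sin (th i))\<^sup>2 \<le> (cos (th i))\<^sup>2" by (simp add: cos_squared_eq)
  qed
  moreover have "(real n - 1) * (1 - d) \<le> (real n - 1) * c"
    using c n0 by (intro mult_left_mono) auto
  ultimately have CS: "(\<Sum>i=1..n. (cos (th i))\<^sup>2) \<le> 1 + (real n - 1) * c"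
      "(\<Sum>i=1..n. (sin (th i))\<^sup>2) \<le> 1 + (real n - 1) * c"
    using C by auto
  have sep: "sin (th 1 - th n) \<noteq> 0"
  proof -
    have "0 < pi / (2 * real n)" "pi / (2 * real n) < pi / 2"
      using n0 by (auto simp: field_simps)
    then have "path_mode n 1 > 0"
      unfolding path_mode_def by (intro cos_gt_zero_pi) auto
    then have pos: "th 1 > 0" using e by (simp add: th_def)
    have "th n = - th 1" using reflect [of 1] n by simp
    moreover have "th 1 < 1"
      using th2_le [of 1] e2_le d by (intro power2_less_imp_less [of _ 1]) auto
    ultimately show ?thesis
      using pos pi_gt3 sin_gt_zero [of "2 * th 1"] by simp
  qed
  have "1 - (\<Sum>i=1..<n. (th (Suc i) - th i)\<^sup>2) / 2 \<le> (\<Prod>i=1..<n. cos (th (Suc i) - th i))"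
  proof (rule prod_cos_ge)
    fix i
    have "(th (Suc i) - th i)\<^sup>2 \<le> 2 * (th (Suc i))\<^sup>2 + 2 * (th i)\<^sup>2"
      using zero_le_power2 [of "th (Suc i) + th i"] by (simp add: power2_eq_square algebra_simps)
    then show "(th (Suc i) - th i)\<^sup>2 \<le> 2" using th2_le [of i] th2_le [of "Suc i"] e2_le d by linarith
  qed simp
  also have "\<dots> \<le> f_rate TYPE('a) n c"
    using d c by (intro embedded_plane_f_rate_ge [OF inj n _ sep orth CS]) auto
  finally have main: "1 - (\<Sum>i=1..<n. (th (Suc i) - th i)\<^sup>2) / 2 \<le> f_rate TYPE('a) n c" .
  have "(\<Sum>i=1..<n. (th (Suc i) - th i)\<^sup>2) = e2 * (2 * real n * (sin (pi / (2 * real n)))\<^sup>2)"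
    unfolding sum_path_mode_steps [OF n, symmetric] sum_distrib_left
    by (simp add: th_def e(2) [symmetric] power_mult_distrib right_diff_distrib [symmetric])
  then have "(\<Sum>i=1..<n. (th (Suc i) - th i)\<^sup>2) / 2 = (e2 * real n) * (sin (pi / (2 * real n)))\<^sup>2"
    by simp
  moreover have "e2 * real n = 2 * (real n - 1) * d + 6 * d\<^sup>2 * real n"
    using n0 by (simp add: e2_def distrib_right)
  ultimately have "(\<Sum>i=1..<n. (th (Suc i) - th i)\<^sup>2) / 2 =
      2 * (real n - 1) * (sin (pi / (2 * real n)))\<^sup>2 * d
      + 6 * real n * d\<^sup>2 * (sin (pi / (2 * real n)))\<^sup>2"
    by (simp add: algebra_simps)
  moreover have "6 * real n * d\<^sup>2 * (sin (pi / (2 * real n)))\<^sup>2 \<le> 6 * real n * d\<^sup>2 * 1"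
    by (intro mult_left_mono) (auto simp: abs_square_le_1)
  ultimately show ?thesis using main by linarith
qed

text \<open>
  A pair of complex numbers amounts to four real coordinates, and a bijection between \<open>\<real> \<times> \<real>\<close> and \<open>\<real>\<close>
  compresses these to one.
\<close>

lemma complex_plane_embeds:
  assumes "(UNIV :: real set) \<lesssim> (UNIV :: 'a set)"
  obtains g :: "complex \<times> complex \<Rightarrow> 'a" where "inj g"
proof -
  have "(UNIV :: real set) \<times> (UNIV :: real set) \<approx> (UNIV :: real set)"
    using card_of_Times_same_infinite [of "UNIV :: real set"] infinite_UNIV_char_0
    by (auto simp: card_of_ordIso [symmetric] eqpoll_def)
  then obtain f :: "real \<times> real \<Rightarrow> real" where f: "inj f"
    by (auto simp: eqpoll_def bij_betw_def)
  obtain h :: "real \<Rightarrow> 'a" where h: "inj h" using assms by (auto simp: lepoll_def)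
  have "inj (\<lambda>u :: complex \<times> complex.
      h (f (f (Re (fst u), Im (fst u)), f (Re (snd u), Im (snd u)))))"
    by (rule injI) (auto simp: inj_eq [OF f] inj_eq [OF h] prod_eq_iff complex_eq_iff)
  then show thesis by (rule that)
qed

theorem theorem2p7:
  fixes n :: nat
  assumes "n \<ge> 2"
    and "(UNIV :: real set) \<lesssim> (UNIV :: 'a set)"
  shows "\<exists>b>0. \<forall>c\<in>{0..1}.
    f_rate TYPE('a) n c \<ge>
      1 - (2 * (real n - 1) * (sin (pi / (2 * real n)))\<^sup>2) * (1 - c) - b * (1 - c)\<^sup>2"
proof -
  obtain g :: "complex \<times> complex \<Rightarrow> 'a" where g: "inj g"
    using complex_plane_embeds [OF assms(2)] .
  define a where "a = 2 * (real n - 1) * (sin (pi / (2 * real n)))\<^sup>2"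
  \<comment> \<open>The summand \<open>6 n\<close> serves \<open>1 - c \<le> 1/6\<close>; the summand 36 makes the bound nonpositive beyond.\<close>
  define b where "b = 6 * real n + 36"
  have a: "0 \<le> a" using assms(1) by (simp add: a_def)
  have near: "1 - a * d - b * d\<^sup>2 \<le> f_rate TYPE('a) n c"
    if "0 < d" "d \<le> 1 / 6" "1 - d \<le> c" for c d
    using f_rate_ge_near_1 [OF g assms(1) that] zero_le_power2 [of d]
    unfolding a_def b_def distrib_right by linarith
  have "1 - a * (1 - c) - b * (1 - c)\<^sup>2 \<le> f_rate TYPE('a) n c" if c: "0 \<le> c" "c \<le> 1" for c
  proof -
    consider "c = 1" | "0 < 1 - c" "1 - c \<le> 1 / 6" | "1 / 6 < 1 - c" using c by linarith
    then show ?thesis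
    proof cases
      case 1
      \<comment> \<open>For \<open>d = 0\<close> the lines would coincide, so \<open>c = 1\<close> is treated as the limit \<open>d = 1 / k \<rightarrow> 0\<close>.\<close>
      have "(\<lambda>k. 1 - a * (1 / real k) - b * (1 / real k)\<^sup>2) \<longlonglongrightarrow> 1 - a * 0 - b * 0\<^sup>2"
        by (intro tendsto_intros lim_1_over_n)
      moreover have "1 - a * (1 / real k) - b * (1 / real k)\<^sup>2 \<le> f_rate TYPE('a) n c" if "k \<ge> 6" for k
        using that 1 by (intro near) (auto simp: field_simps)
      ultimately show ?thesis
        using 1 LIMSEQ_le_const2 [of _ "1 - a * 0 - b * 0\<^sup>2" "f_rate TYPE('a) n c"] by auto
    next
      case 2
      then show ?thesis by (intro near) auto
    next
      case 3
      have "1 \<le> 36 * (1 - c)\<^sup>2" using 3 power_mono [of "1 / 6" "1 - c" 2] by (simp add: power_divide)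
      also have "\<dots> \<le> b * (1 - c)\<^sup>2" by (intro mult_right_mono) (auto simp: b_def)
      finally have "1 - a * (1 - c) - b * (1 - c)\<^sup>2 \<le> 0"
        using mult_nonneg_nonneg [OF a, of "1 - c"] c by linarith
      also have "0 \<le> f_rate TYPE('a) n c" using assms(1) c by (intro f_rate_nonneg [OF g]) auto
      finally show ?thesis .
    qed
  qed
  moreover have "0 < b" by (simp add: b_def add_nonneg_pos)
  ultimately show ?thesis unfolding a_def by (intro exI [of _ b]) auto
qed

end
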